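(* For every test-free limit-matching rPrompt-LDL formula $\varphi$ and every $\beta \in \mathbb{B}_4$, there is a Prompt-LDL formula $\varphi_\beta$ such that $V_{\mathrm{rPromptLDL}}(w, k, \varphi) \succeq \beta$ if and only if $V_{\mathrm{PromptLDL}}(w, k, \varphi_\beta) = 1$ (for every trace $w$ and every bound $k\in\mathbb{N}$).
   Context: Fix a finite set $P$ of atomic propositions; traces are $w\in(2^P)^\omega$. Truth values for robust semantics are $\mathbb{B}_4=\{0000,0001,0011,0111,1111\}$ ordered $0000\prec 0001\prec 0011\prec 0111\prec 1111$. rPrompt-LDL formulas are given by $\varphi ::= p \mid \neg p \mid \varphi\wedge\varphi \mid \varphi\vee\varphi \mid \langle r\rangle^{\cdot}\varphi \mid [r]^{\cdot}\varphi \mid \langle r\rangle^{\cdot}_{\mathbf{p}}\varphi$ with guards $r ::= \phi \mid \varphi? \mid r+r \mid r\,;r \mid r^*$ (negation only on atoms, no implication). Their semantics is an evaluation function $V_{\mathrm{rPromptLDL}}(w,k,\varphi)\in\mathbb{B}_4$ depending on a bound $k$: it is the robust (five-valued) semantics of robust LDL (robust diamond = bitwise maximum over $r$-matches; robust box with bits meaning "all / almost all / infinitely many / some $r$-matches satisfy $\varphi$", with special cases for finitely many or no matches), extended by the prompt diamond $\langle r\rangle^{\cdot}_{\mathbf{p}}\varphi$, which maximizes only over $r$-matches at positions $0,\dots,k$. Prompt-LDL is the Boolean-valued logic with the same (negation-normal-form) syntax and operators $\langle r\rangle$, $[r]$, $\langle r\rangle_{\mathbf{p}}$, with evaluation function $V_{\mathrm{PromptLDL}}(w,k,\varphi)\in\{0,1\}$,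 where $\langle r\rangle_{\mathbf{p}}\varphi$ requires a $\varphi$-satisfying $r$-match within the first $k$ positions. A guard is test-free if it contains no tests $\varphi?$ (only propositional formulas as atoms); for test-free $r$ the set $\mathcal{R}(w,r)$ of positions $j$ such that $w(0)\cdots w(j-1)$ matches $r$ is independent of the bit index and of $k$. A test-free guard $r$ is limit-matching if $\mathcal{R}(w,r)$ is infinite for every trace $w$. A formula is test-free (resp. limit-matching) if all its guards are. *)

theory Defs
  imports Main "HOL-Library.Omega_Words_Fun"
begin

subsection \<open>Five truth values\<close>

datatype b4 = B0000 | B0001 | B0011 | B0111 | B1111

primrec ones :: "b4 \<Rightarrow> nat" where
  "ones B0000 = 0"
| "ones B0001 = 1"
| "ones B0011 = 2"
| "ones B0111 = 3"
| "ones B1111 = 4"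

lemma ones_inject: "ones a = ones b \<longleftrightarrow> a = b"
  by (cases a; cases b) auto

instantiation b4 :: linorder
begin

definition less_eq_b4 :: "b4 \<Rightarrow> b4 \<Rightarrow> bool" where
  "a \<le> b \<longleftrightarrow> ones a \<le> ones b"

definition less_b4 :: "b4 \<Rightarrow> b4 \<Rightarrow> bool" where
  "a < b \<longleftrightarrow> ones a < ones b"

instance
  by standard (auto simp: less_eq_b4_def less_b4_def ones_inject)

end

text \<open>Bits are numbered 1 to 4 from the left, so the value \<open>B0001\<close> has only bit 4 set.\<close>

definition bit4 :: "nat \<Rightarrow> b4 \<Rightarrow> bool" where
  "bit4 i b \<longleftrightarrow> 5 \<le> ones b + i"

text \<open>
  The truth value \<open>b\<^sub>1b\<^sub>2b\<^sub>3b\<^sub>4\<close> with \<open>b\<^sub>i = max {f 1, \<dots>, f i}\<close>;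
  see \<open>bit4_of_bits\<close>. If \<open>f\<close> is monotone, this is just the value with bits \<open>f 1, \<dots>, f 4\<close>.
\<close>

definition of_bits :: "(nat \<Rightarrow> bool) \<Rightarrow> b4" where
  "of_bits f =
     (if f 1 then B1111 else if f 2 then B0111 else if f 3 then B0011
      else if f 4 then B0001 else B0000)"

lemma atLeastAtMost_1_4: "{1..4} = {1, 2, 3, 4 :: nat}"
  by auto

lemma bit4_of_bits:
  assumes "i \<in> {1..4}"
  shows "bit4 i (of_bits f) \<longleftrightarrow> (\<exists>i'\<in>{1..i}. f i')"
proof -
  have eqs: "{1..1} = {1 :: nat}" "{1..2} = {1, 2 :: nat}" "{1..3} = {1, 2, 3 :: nat}"
    by auto
  have "i = 1 \<or> i = 2 \<or> i = 3 \<or> i = 4"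
    using assms by auto
  then show ?thesis
    by (elim disjE) (simp_all only: eqs atLeastAtMost_1_4, auto simp: of_bits_def bit4_def)
qed


subsection \<open>Guards and their matches\<close>

datatype 'p pform =
    PTrue
  | PAtom 'p
  | PNeg "'p pform"
  | PAnd "'p pform" "'p pform"
  | POr "'p pform" "'p pform"

primrec pform_holds :: "'p set \<Rightarrow> 'p pform \<Rightarrow> bool" where
  "pform_holds A PTrue \<longleftrightarrow> True"
| "pform_holds A (PAtom p) \<longleftrightarrow> p \<in> A"
| "pform_holds A (PNeg f) \<longleftrightarrow> \<not> pform_holds A f"
| "pform_holds A (PAnd f g) \<longleftrightarrow> pform_holds A f \<and> pform_holds A g"
| "pform_holds A (POr f g) \<longleftrightarrow> pform_holds A f \<or> pform_holds A g"

text \<open>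
  Guards are parametrised by the type \<open>'f\<close> of the formulas that may be tested, so that both
  logics can share them; \<open>tests r\<close> is the set of formulas tested in \<open>r\<close>.
\<close>

datatype (guard_atoms: 'p, tests: 'f) guard =
    Prop "'p pform"
  | Test 'f
  | Plus "('p, 'f) guard" "('p, 'f) guard"
  | Seq "('p, 'f) guard" "('p, 'f) guard"
  | Star "('p, 'f) guard"

lemma size_tests [termination_simp]:
  assumes "\<phi> \<in> tests r"
  shows "size \<phi> < Suc (size_guard (\<lambda>_. 0) size r + n)"
proof -
  have "size \<phi> \<le> size_guard (\<lambda>_. 0) size r"
    using assms by (induction r) auto
  then show ?thesis
    by simp
qed

text \<open>
  \<open>matches T r w\<close> is the set of all \<open>j\<close> such that \<open>w(0) \<dots> w(j - 1)\<close> matches \<open>r\<close>, where \<open>T\<close>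
  decides the truth of tests. A match of \<open>r\<^sup>*\<close> is a position reachable from 0 by finitely many
  (possibly zero) steps from some \<open>m\<close> to \<open>m + d\<close>, where \<open>d\<close> is an \<open>r\<close>-match in the suffix at \<open>m\<close>.
\<close>

primrec matches :: "('p set word \<Rightarrow> 'f \<Rightarrow> bool) \<Rightarrow> ('p, 'f) guard \<Rightarrow> 'p set word \<Rightarrow> nat set" where
  "matches T (Prop f) w = (if pform_holds (w 0) f then {1} else {})"
| "matches T (Test \<phi>) w = (if T w \<phi> then {0} else {})"
| "matches T (Plus r s) w = matches T r w \<union> matches T s w"
| "matches T (Seq r s) w = {m + n |m n. m \<in> matches T r w \<and> n \<in> matches T s (suffix m w)}"
| "matches T (Star r) w =
     {j. (0, j) \<in> {(m, m + d) |m d. d \<in> matches T r (suffix m w)}\<^sup>*}"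

lemma matches_cong [fundef_cong]:
  assumes "r = r'" "w = w'" "\<And>v \<phi>. \<phi> \<in> tests r' \<Longrightarrow> T v \<phi> = T' v \<phi>"
  shows "matches T r w = matches T' r' w'"
proof -
  have "matches T r v = matches T' r v" if "\<And>u \<phi>. \<phi> \<in> tests r \<Longrightarrow> T u \<phi> = T' u \<phi>" for v
    using that by (induction r arbitrary: v) simp_all
  then show ?thesis
    using assms by blast
qed

lemma matches_mono:
  assumes "\<And>v \<phi>. T v \<phi> \<Longrightarrow> T' v \<phi>"
  shows "matches T r w \<subseteq> matches T' r w"
proof (induction r arbitrary: w)
  case (Star r)
  have "{(m, m + d) |m d. d \<in> matches T r (suffix m w)}
      \<subseteq> {(m, m + d) |m d. d \<in> matches T' r (suffix m w)}"
    using Star.IH by blast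
  from rtrancl_mono[OF this] show ?case
    by (simp add: Collect_mono_iff subset_iff)
qed (use assms in auto, blast+)

definition test_free_guard :: "('p, 'f) guard \<Rightarrow> bool" where
  "test_free_guard r \<longleftrightarrow> tests r = {}"

text \<open>For test-free guards, the interpretation of tests is irrelevant.\<close>

definition test_free_matches :: "('p, 'f) guard \<Rightarrow> 'p set word \<Rightarrow> nat set" where
  "test_free_matches r w = matches (\<lambda>_ _. False) r w"

lemma matches_test_free: "test_free_guard r \<Longrightarrow> matches T r w = test_free_matches r w"
  unfolding test_free_guard_def test_free_matches_def by (rule matches_cong) auto

definition limit_matching_guard :: "('p, 'f) guard \<Rightarrow> bool" where
  "limit_matching_guard r \<longleftrightarrow> test_free_guard r \<and> (\<forall>w. infinite (test_free_matches r w))"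


subsection \<open>Prompt-LDL\<close>

datatype 'p prompt_ldl =
    Atom 'p
  | NAtom 'p
  | And "'p prompt_ldl" "'p prompt_ldl"
  | Or "'p prompt_ldl" "'p prompt_ldl"
  | Dia "('p, 'p prompt_ldl) guard" "'p prompt_ldl"
  | Box "('p, 'p prompt_ldl) guard" "'p prompt_ldl"
  | PDia "('p, 'p prompt_ldl) guard" "'p prompt_ldl"

function V_PromptLDL :: "'p set word \<Rightarrow> nat \<Rightarrow> 'p prompt_ldl \<Rightarrow> bool" where
  "V_PromptLDL w k (Atom p) \<longleftrightarrow> p \<in> w 0"
| "V_PromptLDL w k (NAtom p) \<longleftrightarrow> p \<notin> w 0"
| "V_PromptLDL w k (And \<phi> \<psi>) \<longleftrightarrow> V_PromptLDL w k \<phi> \<and> V_PromptLDL w k \<psi>"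
| "V_PromptLDL w k (Or \<phi> \<psi>) \<longleftrightarrow> V_PromptLDL w k \<phi> \<or> V_PromptLDL w k \<psi>"
| "V_PromptLDL w k (Dia r \<phi>) \<longleftrightarrow>
     (\<exists>j \<in> matches (\<lambda>v \<psi>. V_PromptLDL v k \<psi>) r w. V_PromptLDL (suffix j w) k \<phi>)"
| "V_PromptLDL w k (Box r \<phi>) \<longleftrightarrow>
     (\<forall>j \<in> matches (\<lambda>v \<psi>. V_PromptLDL v k \<psi>) r w. V_PromptLDL (suffix j w) k \<phi>)"
| "V_PromptLDL w k (PDia r \<phi>) \<longleftrightarrow>
     (\<exists>j \<in> matches (\<lambda>v \<psi>. V_PromptLDL v k \<psi>) r w \<inter> {0..k}. V_PromptLDL (suffix j w) k \<phi>)"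
  by pat_completeness auto
termination
  by (relation "measure (\<lambda>(w, k, \<phi>). size \<phi>)") (auto simp: termination_simp)


subsection \<open>rPrompt-LDL\<close>

datatype 'p rprompt_ldl =
    RAtom 'p
  | RNAtom 'p
  | RAnd "'p rprompt_ldl" "'p rprompt_ldl"
  | ROr "'p rprompt_ldl" "'p rprompt_ldl"
  | RDia "('p, 'p rprompt_ldl) guard" "'p rprompt_ldl"
  | RBox "('p, 'p rprompt_ldl) guard" "'p rprompt_ldl"
  | RPDia "('p, 'p rprompt_ldl) guard" "'p rprompt_ldl"

text \<open>
  The \<open>i\<close>-th bit of a robust box before accumulation, for the set \<open>R\<close> of matches and the
  predicate \<open>S\<close> of positions satisfying the argument. If \<open>R\<close> is finite, ``almost all''
  is read as ``all'' and ``infinitely many'' as ``some''; without matches every bit is 1.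
\<close>

definition robust_box :: "nat \<Rightarrow> nat set \<Rightarrow> (nat \<Rightarrow> bool) \<Rightarrow> bool" where
  "robust_box i R S \<longleftrightarrow>
     (if R = {} then True
      else if i = 1 then \<forall>j\<in>R. S j
      else if i = 2 then
        (if infinite R then \<exists>m. \<forall>j \<in> R \<inter> {m..}. S j else \<forall>j\<in>R. S j)
      else if i = 3 then
        (if infinite R then \<forall>m. \<exists>j \<in> R \<inter> {m..}. S j else \<exists>j\<in>R. S j)
      else \<exists>j\<in>R. S j)"

text \<open>
  Tests inside guards are evaluated bitwise: bit \<open>i\<close> of a modal formula uses the matches
  obtained by evaluating tests at bit \<open>i\<close>. The bits of the two diamonds are monotone, hence
  not altered by \<open>of_bits\<close>; see \<open>bit4_RDia\<close> and \<open>bit4_RPDia\<close>. For the box,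
  \<open>of_bits\<close> accumulates the bits from left to right.
\<close>

function V_rPromptLDL :: "'p set word \<Rightarrow> nat \<Rightarrow> 'p rprompt_ldl \<Rightarrow> b4" where
  "V_rPromptLDL w k (RAtom p) = (if p \<in> w 0 then B1111 else B0000)"
| "V_rPromptLDL w k (RNAtom p) = (if p \<in> w 0 then B0000 else B1111)"
| "V_rPromptLDL w k (RAnd \<phi> \<psi>) = min (V_rPromptLDL w k \<phi>) (V_rPromptLDL w k \<psi>)"
| "V_rPromptLDL w k (ROr \<phi> \<psi>) = max (V_rPromptLDL w k \<phi>) (V_rPromptLDL w k \<psi>)"
| "V_rPromptLDL w k (RDia r \<phi>) = of_bits (\<lambda>i.
     \<exists>j \<in> matches (\<lambda>v \<psi>. bit4 i (V_rPromptLDL v k \<psi>)) r w.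
       bit4 i (V_rPromptLDL (suffix j w) k \<phi>))"
| "V_rPromptLDL w k (RBox r \<phi>) = of_bits (\<lambda>i.
     robust_box i (matches (\<lambda>v \<psi>. bit4 i (V_rPromptLDL v k \<psi>)) r w)
       (\<lambda>j. bit4 i (V_rPromptLDL (suffix j w) k \<phi>)))"
| "V_rPromptLDL w k (RPDia r \<phi>) = of_bits (\<lambda>i.
     \<exists>j \<in> matches (\<lambda>v \<psi>. bit4 i (V_rPromptLDL v k \<psi>)) r w \<inter> {0..k}.
       bit4 i (V_rPromptLDL (suffix j w) k \<phi>))"
  by pat_completeness auto
termination
  by (relation "measure (\<lambda>(w, k, \<phi>). size \<phi>)") (auto simp: termination_simp)

lemma bit4_mono: "bit4 i b \<Longrightarrow> i \<le> i' \<Longrightarrow> bit4 i' b"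
  by (simp add: bit4_def)

lemma robust_matches_mono:
  "i \<le> i' \<Longrightarrow> matches (\<lambda>v \<psi>. bit4 i (V_rPromptLDL v k \<psi>)) r w
     \<subseteq> matches (\<lambda>v \<psi>. bit4 i' (V_rPromptLDL v k \<psi>)) r w"
  by (rule matches_mono) (rule bit4_mono)

lemma bit4_RDia:
  assumes "i \<in> {1..4}"
  shows "bit4 i (V_rPromptLDL w k (RDia r \<phi>)) \<longleftrightarrow>
    (\<exists>j \<in> matches (\<lambda>v \<psi>. bit4 i (V_rPromptLDL v k \<psi>)) r w.
       bit4 i (V_rPromptLDL (suffix j w) k \<phi>))" (is "_ \<longleftrightarrow> ?P i")
proof -
  have "?P i" if "?P i'" "i' \<le> i" for i'
    using that robust_matches_mono[OF \<open>i' \<le> i\<close>, of k r w] bit4_mono[OF _ \<open>i' \<le> i\<close>] by blast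
  then have "(\<exists>i'\<in>{1..i}. ?P i') \<longleftrightarrow> ?P i"
    using assms by (meson atLeastAtMost_iff order_refl)
  then show ?thesis
    unfolding V_rPromptLDL.simps bit4_of_bits[OF assms] .
qed

lemma bit4_RPDia:
  assumes "i \<in> {1..4}"
  shows "bit4 i (V_rPromptLDL w k (RPDia r \<phi>)) \<longleftrightarrow>
    (\<exists>j \<in> matches (\<lambda>v \<psi>. bit4 i (V_rPromptLDL v k \<psi>)) r w \<inter> {0..k}.
       bit4 i (V_rPromptLDL (suffix j w) k \<phi>))" (is "_ \<longleftrightarrow> ?P i")
proof -
  have "?P i" if "?P i'" "i' \<le> i" for i'
    using that robust_matches_mono[OF \<open>i' \<le> i\<close>, of k r w] bit4_mono[OF _ \<open>i' \<le> i\<close>] by blast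
  then have "(\<exists>i'\<in>{1..i}. ?P i') \<longleftrightarrow> ?P i"
    using assms by (meson atLeastAtMost_iff order_refl)
  then show ?thesis
    unfolding V_rPromptLDL.simps bit4_of_bits[OF assms] .
qed

fun guards :: "'p rprompt_ldl \<Rightarrow> ('p, 'p rprompt_ldl) guard set" where
  "guards (RAtom p) = {}"
| "guards (RNAtom p) = {}"
| "guards (RAnd \<phi> \<psi>) = guards \<phi> \<union> guards \<psi>"
| "guards (ROr \<phi> \<psi>) = guards \<phi> \<union> guards \<psi>"
| "guards (RDia r \<phi>) = {r} \<union> (\<Union>\<psi>\<in>tests r. guards \<psi>) \<union> guards \<phi>"
| "guards (RBox r \<phi>) = {r} \<union> (\<Union>\<psi>\<in>tests r. guards \<psi>) \<union> guards \<phi>"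
| "guards (RPDia r \<phi>) = {r} \<union> (\<Union>\<psi>\<in>tests r. guards \<psi>) \<union> guards \<phi>"

definition test_free :: "'p rprompt_ldl \<Rightarrow> bool" where
  "test_free \<phi> \<longleftrightarrow> (\<forall>r\<in>guards \<phi>. test_free_guard r)"

definition limit_matching :: "'p rprompt_ldl \<Rightarrow> bool" where
  "limit_matching \<phi> \<longleftrightarrow> (\<forall>r\<in>guards \<phi>. limit_matching_guard r)"

end

theory Submission imports Defs begin

text \<open>
  Each bit of a formula is translated separately. Bits 1 and 4 of a box become \<open>Box\<close> and \<open>Dia\<close>. For
  bits 2 and 3 one must speak about the matches of \<open>r\<close> from some position \<open>m\<close> onwards, and
  these depend on the prefix up to \<open>m\<close> only through one of finitely many residuals \<open>X\<close>. Viewing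
  the residuals as states of a deterministic automaton, Kleene's theorem yields guards \<open>g\<^sub>X\<close>
  for the prefixes with residual \<open>X\<close> and \<open>h\<^sub>X\<close> for the remaining matches. As \<open>r\<close> has
  infinitely many matches, bit 2 becomes the disjunction over \<open>X\<close> of \<open>\<langle>g\<^sub>X\<rangle>[h\<^sub>X]\<psi>\<close>
  and bit 3 the conjunction of \<open>[g\<^sub>X]\<langle>h\<^sub>X\<rangle>\<psi>\<close>.
\<close>

subsection \<open>Matches of iterated guards\<close>

lemma star_zero: "0 \<in> matches T (Star r) w"
  by simp

lemma star_step:
  assumes "m \<in> matches T (Star r) w" "d \<in> matches T r (suffix m w)"
  shows "m + d \<in> matches T (Star r) w"
  using assms by (auto intro: rtrancl_into_rtrancl)

text \<open>Steps are appended at the end, as in \<open>star_step\<close>, so the closure behind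
  \<open>Star\<close> need not be unfolded again.\<close>

lemma star_induct [consumes 1, case_names zero step]:
  assumes "j \<in> matches T (Star r) w"
    and "P 0"
    and "\<And>m d. m \<in> matches T (Star r) w \<Longrightarrow> P m \<Longrightarrow> d \<in> matches T r (suffix m w) \<Longrightarrow> P (m + d)"
  shows "P j"
proof -
  have "(0, j) \<in> {(m, m + d) |m d. d \<in> matches T r (suffix m w)}\<^sup>*"
    using assms(1) by simp
  then show ?thesis
  proof (induction rule: rtrancl_induct)
    case base
    then show ?case by (rule assms(2))
  next
    case (step y z)
    then show ?case using assms(3)[of y] by auto
  qed
qed

lemma star_add:
  assumes "m \<in> matches T (Star r) w" "n \<in> matches T (Star r) (suffix m w)"
  shows "m + n \<in> matches T (Star r) w"
  using assms(2)
proof (induction rule: star_induct)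
  case zero
  then show ?case using assms(1) by simp
next
  case (step n d)
  then show ?case using star_step[of "m + n" T r w d] by (simp add: add.assoc)
qed

lemma star_one: "d \<in> matches T r w \<Longrightarrow> d \<in> matches T (Star r) w"
  using star_step[OF star_zero, of d T r w] by simp

lemma matches_map_guard:
  "matches T (map_guard id f r) w = matches (\<lambda>v x. T v (f x)) r w"
  by (induction r arbitrary: w) (simp_all add: pform.map_id)


subsection \<open>Residuals\<close>

text \<open>Letters are read only by \<open>Prop\<close>, which moves past the letter it has read,
  and \<open>test_free_matches\<close> takes every test as false. So a match cannot look beyond its
  own end.\<close>

lemma matches_local:
  assumes "\<And>i. i < j \<Longrightarrow> w i = w' i" "j \<in> test_free_matches r w"
  shows "j \<in> test_free_matches r w'"
  using assms unfolding test_free_matches_def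
proof (induction r arbitrary: w w' j)
  case (Prop f)
  show ?case
  proof (cases "j = 1")
    case True
    then have "w 0 = w' 0" using Prop.prems(1) by simp
    then show ?thesis using Prop.prems(2) by simp
  qed (use Prop.prems(2) in \<open>simp split: if_splits\<close>)
next
  case (Plus r s)
  have "j \<in> matches (\<lambda>_ _. False) r w'" if "j \<in> matches (\<lambda>_ _. False) r w"
    using that by (rule Plus.IH(1)[rotated]) (rule Plus.prems(1))
  moreover have "j \<in> matches (\<lambda>_ _. False) s w'" if "j \<in> matches (\<lambda>_ _. False) s w"
    using that by (rule Plus.IH(2)[rotated]) (rule Plus.prems(1))
  ultimately show ?case using Plus.prems(2) unfolding matches.simps(3) by blast
next
  case (Seq r s)
  from Seq.prems(2) obtain m n where j: "j = m + n" "m \<in> matches (\<lambda>_ _. False) r w"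
    "n \<in> matches (\<lambda>_ _. False) s (suffix m w)" unfolding matches.simps(4) by blast
  have "m \<in> matches (\<lambda>_ _. False) r w'"
    using j(2) by (rule Seq.IH(1)[rotated]) (use Seq.prems(1) j(1) in simp)
  moreover have "n \<in> matches (\<lambda>_ _. False) s (suffix m w')"
    using j(3) by (rule Seq.IH(2)[rotated]) (use Seq.prems(1) j(1) in simp)
  ultimately show ?case using j(1) unfolding matches.simps(4) by blast
next
  case (Star r)
  \<comment> \<open>The agreement of \<open>w\<close> and \<open>w'\<close> is carried into the
    induction, because the range on which it is known changes with the position.\<close>
  from Star.prems(2,1) show ?case
  proof (induction rule: star_induct)
    case zero
    show ?case by (rule star_zero)
  next
    case (step m d)
    have "m \<in> matches (\<lambda>_ _. False) (Star r) w'"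
      by (rule step.IH) (use step.prems in simp)
    moreover have "d \<in> matches (\<lambda>_ _. False) r (suffix m w')"
      using step.hyps(2) by (rule Star.IH[rotated]) (use step.prems in simp)
    ultimately show ?case by (rule star_step)
  qed
qed simp

text \<open>The left quotient (Brzozowski derivative) of \<open>M\<close> by \<open>u\<close>, taken
  as a semantic function so that equal quotients are literally equal.\<close>

definition residual :: "('a word \<Rightarrow> nat set) \<Rightarrow> 'a list \<Rightarrow> 'a word \<Rightarrow> nat set" where
  "residual M u v = {j. length u + j \<in> M (u \<frown> v)}"

lemma suffix_conc_le: "p \<le> length u \<Longrightarrow> suffix p (u \<frown> v) = drop p u \<frown> v"
  by (rule ext) (auto simp: conc_def add.commute)

lemma suffix_conc_ge: "suffix (length u + p) (u \<frown> v) = suffix p v"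
  by (rule ext) (auto simp: conc_def)

lemma matches_conc_indep:
  assumes "p \<le> length u"
  shows "p \<in> test_free_matches r (u \<frown> v) \<longleftrightarrow> p \<in> test_free_matches r (u \<frown> v')"
  using assms by (auto elim!: matches_local[rotated] simp: conc_def)

text \<open>The continuation \<open>\<lambda>_. {}\<close> is arbitrary, by \<open>matches_conc_indep\<close>.\<close>

definition reached :: "('p, 'f) guard \<Rightarrow> 'p set list \<Rightarrow> nat set" where
  "reached r u = {p. p \<le> length u \<and> p \<in> test_free_matches r (u \<frown> (\<lambda>_. {}))}"

lemma reached_iff:
  "p \<in> reached r u \<longleftrightarrow> p \<le> length u \<and> p \<in> test_free_matches r (u \<frown> v)"
  unfolding reached_def using matches_conc_indep by blast

text \<open>
  The residual of \<open>Seq r s\<close> is determined by that of \<open>r\<close> and by the set of residuals of \<open>s\<close> after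
  those suffixes of \<open>u\<close> that remain when a match of \<open>r\<close> is removed; \<open>residual_Star\<close> is analogous.
  Hence finiteness is inherited.
\<close>

lemma residual_Seq:
  fixes r s :: "('p, 'f) guard"
  defines "A \<equiv> test_free_matches r" and "B \<equiv> test_free_matches s"
  shows "residual (test_free_matches (Seq r s)) u v =
    {m + n |m n. m \<in> residual A u v \<and> n \<in> B (suffix m v)}
    \<union> (\<Union>X \<in> (\<lambda>p. residual B (drop p u)) ` reached r u. X v)"
proof -
  have Seq: "t \<in> test_free_matches (Seq r s) w \<longleftrightarrow>
    (\<exists>m n. t = m + n \<and> m \<in> A w \<and> n \<in> B (suffix m w))" for t w
    by (simp add: test_free_matches_def A_def B_def)
  \<comment> \<open>Either \<open>r\<close> runs on to the end of \<open>u\<close> or beyond it, or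
    it ends within \<open>u\<close> and leaves a suffix of \<open>u\<close> to \<open>s\<close>. The
    boundary belongs to both cases, which a union permits.\<close>
  have "length u + j \<in> test_free_matches (Seq r s) (u \<frown> v) \<longleftrightarrow>
    (\<exists>m n. j = m + n \<and> length u + m \<in> A (u \<frown> v) \<and> n \<in> B (suffix m v))
    \<or> (\<exists>p \<in> reached r u. length u - p + j \<in> B (drop p u \<frown> v))" (is "?L \<longleftrightarrow> ?R1 \<or> ?R2") for j
  proof
    assume ?L
    then obtain m n where mn: "length u + j = m + n" "m \<in> A (u \<frown> v)" "n \<in> B (suffix m (u \<frown> v))"
      using Seq by blast
    show "?R1 \<or> ?R2"
    proof (cases "m \<le> length u")
      case True
      then have "m \<in> reached r u" using mn(2) reached_iff A_def by blast
      moreover have "n = length u - m + j" using mn(1) True by simp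
      then have "length u - m + j \<in> B (drop m u \<frown> v)"
        using mn(3) by (simp only: suffix_conc_le[OF True])
      ultimately have ?R2 by blast
      then show ?thesis ..
    next
      case False
      then obtain m' where "m = length u + m'" by (metis le_add_diff_inverse nat_le_linear)
      then show ?thesis using mn by (auto simp: suffix_conc_ge)
    qed
  next
    assume "?R1 \<or> ?R2"
    then show ?L
    proof
      assume ?R1
      then obtain m n where "j = m + n" "length u + m \<in> A (u \<frown> v)" "n \<in> B (suffix m v)"
        by blast
      then have "length u + j = (length u + m) + n" "n \<in> B (suffix (length u + m) (u \<frown> v))"
        by (simp_all add: suffix_conc_ge)
      then show ?L using Seq \<open>length u + m \<in> A (u \<frown> v)\<close> by blast
    next
      assume ?R2
      then obtain p where p: "p \<in> reached r u" "length u - p + j \<in> B (drop p u \<frown> v)" by blast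
      have "p \<le> length u" "p \<in> A (u \<frown> v)" using p(1) reached_iff A_def by blast+
      then have "length u + j = p + (length u - p + j)" "length u - p + j \<in> B (suffix p (u \<frown> v))"
        using p(2) by (simp_all add: suffix_conc_le)
      then show ?L using Seq \<open>p \<in> A (u \<frown> v)\<close> by blast
    qed
  qed
  then show ?thesis by (auto simp: residual_def)
qed

lemma residual_Star:
  fixes r :: "('p, 'f) guard"
  defines "A \<equiv> test_free_matches r" and "N \<equiv> test_free_matches (Star r)"
  shows "residual N u v =
    (\<Union>X \<in> (\<lambda>p. residual A (drop p u)) ` reached (Star r) u. {m + n |m n. m \<in> X v \<and> n \<in> N (suffix m v)})
    \<union> (if length u \<in> reached (Star r) u then {0} else {})" (is "_ = ?R")
proof
  have N_step: "m \<in> N w \<Longrightarrow> d \<in> A (suffix m w) \<Longrightarrow> m + d \<in> N w"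
    and add: "m \<in> N w \<Longrightarrow> n \<in> N (suffix m w) \<Longrightarrow> m + n \<in> N w"
    and N_0: "0 \<in> N w" for m d n w
    unfolding A_def N_def test_free_matches_def by (rule star_step star_add star_zero; assumption)+
  have reached: "p \<in> reached (Star r) u \<longleftrightarrow> p \<le> length u \<and> p \<in> N (u \<frown> v)" for p
    unfolding N_def by (rule reached_iff)
  show "?R \<subseteq> residual N u v"
  proof -
    have "length u + (m + n) \<in> N (u \<frown> v)"
      if "p \<in> reached (Star r) u" "m \<in> residual A (drop p u) v" "n \<in> N (suffix m v)" for p m n
    proof -
      have p: "p \<le> length u" "p \<in> N (u \<frown> v)" using that(1) reached by auto
      have "length u - p + m \<in> A (suffix p (u \<frown> v))"
        using that(2) p(1) by (simp add: residual_def suffix_conc_le)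
      from N_step[OF p(2) this] have "length u + m \<in> N (u \<frown> v)" using p(1) by simp
      from add[OF this] show ?thesis using that(3) by (simp add: suffix_conc_ge add.assoc)
    qed
    then show ?thesis using reached by (auto simp: residual_def)
  qed
  \<comment> \<open>Induction along the steps leading to \<open>t\<close>. A step that starts no
    later than the end of \<open>u\<close> and ends no earlier supplies \<open>X\<close> and
    \<open>m\<close>; later steps are collected in \<open>n\<close>. Without any step
    \<open>u\<close> is empty, which gives the \<open>0\<close>.\<close>
  have "length u \<le> t \<Longrightarrow> t - length u \<in> ?R" if "t \<in> N (u \<frown> v)" for t
  proof -
    from that have "t \<in> matches (\<lambda>_ _. False) (Star r) (u \<frown> v)"
      by (simp only: N_def test_free_matches_def)
    then show "length u \<le> t \<Longrightarrow> t - length u \<in> ?R"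
    proof (induction rule: star_induct)
      case zero
      then show ?case using reached N_0 by auto
    next
      case (step y d)
      have y: "y \<in> N (u \<frown> v)" and d: "d \<in> A (suffix y (u \<frown> v))"
        using step.hyps by (simp_all only: N_def A_def test_free_matches_def)
      \<comment> \<open>The comparison is strict so that \<open>y' > 0\<close>: then the induction
        hypothesis cannot return the separate \<open>{0}\<close> and must give a decomposition whose
        part \<open>n\<close> absorbs the new step.\<close>
      show ?case
      proof (cases "length u < y")
        case True
        then obtain y' where y': "y = length u + y'" "0 < y'"
          using less_imp_add_positive by blast
        have "y' \<in> ?R" using step.IH unfolding y'(1) diff_add_inverse by (simp only: le_add1)
        with y' obtain p m n where p: "p \<in> reached (Star r) u" "m \<in> residual A (drop p u) v"
          "n \<in> N (suffix m v)" "y' = m + n"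
          by (auto split: if_splits simp del: suffix_nth)
        have "n + d \<in> N (suffix m v)"
          using d p(3,4) y'(1) N_step by (simp add: suffix_conc_ge)
        then show "y + d - length u \<in> ?R"
          using p y' by (auto simp: add.assoc)
      next
        case False
        then have "y \<in> reached (Star r) u" using y reached by simp
        moreover from False have "y + d - length u \<in> residual A (drop y u) v"
          using d step.prems by (simp add: residual_def suffix_conc_le)
        moreover have "y + d - length u = (y + d - length u) + 0" by simp
        ultimately show "y + d - length u \<in> ?R"
          using N_0 by blast
      qed
    qed
  qed
  from this[of "length u + _"] show "residual N u v \<subseteq> ?R"
    by (auto simp only: residual_def mem_Collect_eq diff_add_inverse le_add1)
qed

text \<open>As in the Myhill-Nerode theorem: each residual is the value of a fixed function
  \<open>?f\<close> at data from a finite set. For sequence and star these data include a set of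
  residuals of a part, hence the power sets.\<close>

lemma finite_residuals: "finite (range (residual (test_free_matches r)))"
proof (induction r)
  case (Prop f)
  let ?M = "test_free_matches (Prop f :: ('a, 'b) guard)"
  \<comment> \<open>The three states: nothing read, exactly one satisfying letter read, no further
    match possible.\<close>
  have "residual ?M u \<in> {residual ?M [], \<lambda>_. {0}, \<lambda>_. {}}" for u
  proof (cases u)
    case (Cons a u')
    have "residual ?M u = (\<lambda>_. if pform_holds a f \<and> u' = [] then {0} else {})"
      by (rule ext) (auto simp: Cons residual_def test_free_matches_def)
    then show ?thesis by simp
  qed simp
  then have "range (residual ?M) \<subseteq> {residual ?M [], \<lambda>_. {0}, \<lambda>_. {}}"
    by (rule image_subsetI)
  then show ?case by (rule finite_subset) simp
next
  case (Test x)
  have "range (residual (test_free_matches (Test x))) \<subseteq> {\<lambda>_. {}}"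
    by (auto simp: residual_def test_free_matches_def fun_eq_iff)
  then show ?case by (rule finite_subset) simp
next
  case (Plus r s)
  let ?f = "\<lambda>(X, Y) v. X v \<union> Y v"
  have "residual (test_free_matches (Plus r s)) u =
    ?f (residual (test_free_matches r) u, residual (test_free_matches s) u)" for u
    by (rule ext) (auto simp: residual_def test_free_matches_def)
  then have "range (residual (test_free_matches (Plus r s))) \<subseteq>
    ?f ` (range (residual (test_free_matches r)) \<times> range (residual (test_free_matches s)))"
    by (intro image_subsetI) (simp only: SigmaI rangeI imageI)
  then show ?case by (rule finite_subset) (simp add: Plus.IH)
next
  case (Seq r s)
  let ?f = "\<lambda>(X, Y) v. {m + n |m n. m \<in> X v \<and> n \<in> test_free_matches s (suffix m v)}
    \<union> (\<Union>Z \<in> Y. Z v)"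
  have "residual (test_free_matches (Seq r s)) u =
    ?f (residual (test_free_matches r) u,
        (\<lambda>p. residual (test_free_matches s) (drop p u)) ` reached r u)" for u
    by (rule ext) (simp only: residual_Seq prod.case)
  then have "range (residual (test_free_matches (Seq r s))) \<subseteq>
    ?f ` (range (residual (test_free_matches r)) \<times> Pow (range (residual (test_free_matches s))))"
    by (intro image_subsetI) (simp only:, intro imageI, auto)
  then show ?case by (rule finite_subset) (simp add: Seq.IH)
next
  case (Star r)
  let ?f = "\<lambda>(Y, b) v. (\<Union>X \<in> Y. {m + n |m n. m \<in> X v \<and> n \<in> test_free_matches (Star r) (suffix m v)})
    \<union> (if b then {0} else {})"
  have "residual (test_free_matches (Star r)) u =
    ?f ((\<lambda>p. residual (test_free_matches r) (drop p u)) ` reached (Star r) u,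
        length u \<in> reached (Star r) u)" for u
    by (rule ext) (simp only: residual_Star prod.case)
  then have "range (residual (test_free_matches (Star r))) \<subseteq>
    ?f ` (Pow (range (residual (test_free_matches r))) \<times> UNIV)"
    by (intro image_subsetI) (simp only:, intro imageI, auto)
  then show ?case by (rule finite_subset) (simp add: Star.IH)
qed


subsection \<open>Kleene's theorem\<close>

text \<open>\<open>M\<close> plays the role of a regular language and \<open>g\<close> that of a
  regular expression for it.\<close>

definition guard_for :: "('p, 'f) guard \<Rightarrow> ('p set word \<Rightarrow> nat set) \<Rightarrow> bool" where
  "guard_for g M \<longleftrightarrow> test_free_guard g \<and> (\<forall>w. test_free_matches g w = M w)"

lemma guard_for_empty: "guard_for (Prop (PNeg PTrue)) (\<lambda>w. {})"
  by (auto simp: guard_for_def test_free_guard_def test_free_matches_def)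

lemma guard_for_Plus:
  "guard_for g M \<Longrightarrow> guard_for h N \<Longrightarrow> guard_for (Plus g h) (\<lambda>w. M w \<union> N w)"
  by (auto simp: guard_for_def test_free_guard_def test_free_matches_def)

lemma guard_for_Union:
  assumes "finite I" "\<And>i. i \<in> I \<Longrightarrow> \<exists>g :: ('p, 'f) guard. guard_for g (M i)"
  shows "\<exists>g :: ('p, 'f) guard. guard_for g (\<lambda>w. \<Union>i\<in>I. M i w)"
  using assms
proof (induction I rule: finite_induct)
  case empty
  then show ?case using guard_for_empty by auto
next
  case (insert i I)
  then obtain g h :: "('p, 'f) guard" where
    "guard_for g (M i)" "guard_for h (\<lambda>w. \<Union>i\<in>I. M i w)"
    by (metis insertCI)
  from guard_for_Plus[OF this] show ?case by auto
qed

text \<open>The formula is the conjunction of all literals true in \<open>B\<close>; it exists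
  because there are finitely many atoms. It lets a guard single out one letter.\<close>

lemma pform_for_trace:
  fixes B :: "'p::finite set"
  shows "\<exists>f. \<forall>A. pform_holds A f \<longleftrightarrow> A = B"
proof -
  have "\<exists>f. \<forall>A. pform_holds A f \<longleftrightarrow> A \<inter> Q = B \<inter> Q" if "finite Q" for Q :: "'p set"
    using that
  proof (induction Q rule: finite_induct)
    case empty
    then show ?case by (intro exI[of _ PTrue]) simp
  next
    case (insert p Q)
    then obtain f where f: "pform_holds A f \<longleftrightarrow> A \<inter> Q = B \<inter> Q" for A by blast
    show ?case
      by (rule exI[of _ "PAnd f (if p \<in> B then PAtom p else PNeg (PAtom p))"]) (use f insert(2) in auto)
  qed
  from this[of UNIV] show ?thesis by simp
qed

lemma guard_for_letter:
  fixes L :: "'p::finite set set"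
  shows "\<exists>g :: ('p, 'f) guard. guard_for g (\<lambda>w. if w 0 \<in> L then {1} else {})"
proof -
  have "\<exists>g :: ('p, 'f) guard. guard_for g (\<lambda>w. if w 0 = B then {1} else {})" for B
  proof -
    obtain f where "pform_holds A f \<longleftrightarrow> A = B" for A using pform_for_trace by blast
    then show ?thesis
      by (intro exI[of _ "Prop f"])
        (auto simp: guard_for_def test_free_guard_def test_free_matches_def)
  qed
  then have ex: "\<exists>g :: ('p, 'f) guard. guard_for g (\<lambda>w. \<Union>B\<in>L. if w 0 = B then {1} else {})"
    by (intro guard_for_Union) auto
  have "(\<lambda>w. \<Union>B\<in>L. if w 0 = B then {1} else {}) = (\<lambda>w. if w 0 \<in> L then {1::nat} else {})"
    by (rule ext) auto
  then show ?thesis using ex by (rule subst[where P = "\<lambda>M. \<exists>g. guard_for g M"])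
qed

section \<open>Runs and paths of deterministic automata\<close>

primrec run :: "('q \<Rightarrow> 'a \<Rightarrow> 'q) \<Rightarrow> 'q \<Rightarrow> 'a word \<Rightarrow> nat \<Rightarrow> 'q" where
  "run \<delta> p w 0 = p"
| "run \<delta> p w (Suc n) = \<delta> (run \<delta> p w n) (w n)"

lemma run_add: "run \<delta> p w (m + n) = run \<delta> (run \<delta> p w m) (suffix m w) n"
  by (induction n) simp_all

definition paths :: "('q \<Rightarrow> 'a \<Rightarrow> 'q) \<Rightarrow> 'q set \<Rightarrow> 'q \<Rightarrow> 'q \<Rightarrow> 'a word \<Rightarrow> nat set" where
  "paths \<delta> S p q w = {j. run \<delta> p w j = q \<and> (\<forall>i. 0 < i \<and> i < j \<longrightarrow> run \<delta> p w i \<in> S)}"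

lemma paths_add:
  assumes "m \<in> paths \<delta> S p s w" "n \<in> paths \<delta> S s q (suffix m w)" "s \<in> S"
  shows "m + n \<in> paths \<delta> S p q w"
proof -
  have "run \<delta> p w i \<in> S" if i: "0 < i" "i < m + n" for i
  proof (cases "i \<le> m")
    case True
    then show ?thesis using assms i by (cases "i = m") (auto simp: paths_def)
  next
    case False
    then obtain k where "i = m + k" "0 < k" by (metis less_imp_add_positive not_le)
    then show ?thesis using assms i by (simp add: paths_def run_add)
  qed
  then show ?thesis using assms by (simp add: paths_def run_add)
qed

lemma paths_mono: "S \<subseteq> S' \<Longrightarrow> paths \<delta> S p q w \<subseteq> paths \<delta> S' p q w"
  by (auto simp: paths_def)

text \<open>Cut at the first inner visit to \<open>s\<close>: before it only states of
  \<open>S\<close> occur. As \<open>0 < i\<close>, the rest is strictly shorter, which supports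
  induction on the length.\<close>

lemma paths_insert_cases:
  assumes "j \<in> paths \<delta> (insert s S) p q w" "j \<notin> paths \<delta> S p q w"
  obtains i where "0 < i" "i < j" "i \<in> paths \<delta> S p s w"
    "j - i \<in> paths \<delta> (insert s S) s q (suffix i w)"
proof -
  let ?P = "\<lambda>i. 0 < i \<and> i < j \<and> run \<delta> p w i = s"
  define i where "i = (LEAST i. ?P i)"
  have "\<exists>i. ?P i" using assms by (auto simp: paths_def)
  then have i: "?P i" unfolding i_def by (rule LeastI_ex)
  have "\<not> ?P k" if "k < i" for k using that unfolding i_def by (rule not_less_Least)
  then have first: "i \<in> paths \<delta> S p s w"
    using i assms(1) by (force simp: paths_def)
  have run: "run \<delta> s (suffix i w) n = run \<delta> p w (i + n)" for n
    using i by (simp add: run_add)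
  have "run \<delta> s (suffix i w) n \<in> insert s S" if "0 < n" "n < j - i" for n
    using assms(1) that unfolding run by (simp add: paths_def)
  moreover have "run \<delta> s (suffix i w) (j - i) = q"
    using i assms(1) unfolding run by (simp add: paths_def)
  ultimately have "j - i \<in> paths \<delta> (insert s S) s q (suffix i w)"
    unfolding paths_def by blast
  then show ?thesis using i first that by blast
qed

lemma guard_for_paths:
  fixes \<delta> :: "'q \<Rightarrow> 'p::finite set \<Rightarrow> 'q"
  assumes "finite S"
  shows "\<exists>g :: ('p, 'f) guard. guard_for g (paths \<delta> S p q)"
  using assms
proof (induction S arbitrary: p q rule: finite_induct)
  case empty
  \<comment> \<open>A path of length two or more has an intermediate state at index 1, which the
    empty set forbids.\<close>
  have paths: "paths \<delta> {} p q w =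
    (if p = q then {0} else {}) \<union> (if w 0 \<in> {a. \<delta> p a = q} then {1} else {})" for w
  proof -
    have "j \<in> paths \<delta> {} p q w \<longleftrightarrow> j = 0 \<and> p = q \<or> j = 1 \<and> \<delta> p (w 0) = q" for j
    proof -
      consider "j = 0" | "j = 1" | n where "j = Suc (Suc n)"
        by (metis One_nat_def not0_implies_Suc)
      then show ?thesis
        by cases (auto simp: paths_def intro!: exI[of _ "Suc 0"])
    qed
    then show ?thesis by auto
  qed
  obtain g :: "('p, 'f) guard" where
    g: "guard_for g (\<lambda>w. if w 0 \<in> {a. \<delta> p a = q} then {1} else {})"
    using guard_for_letter by blast
  \<comment> \<open>\<open>Prop (PNeg PTrue)\<close> matches nothing, so its star matches exactly
    the empty prefix.\<close>
  have "guard_for (if p = q then Star (Prop (PNeg PTrue)) else Prop (PNeg PTrue) :: ('p, 'f) guard)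
    (\<lambda>w. if p = q then {0} else {})"
    by (auto simp: guard_for_def test_free_guard_def test_free_matches_def)
  from guard_for_Plus[OF this g] show ?case
    unfolding paths[abs_def] by blast
next
  case (insert s S)
  obtain a b c d :: "('p, 'f) guard" where
    "guard_for a (paths \<delta> S p q)" "guard_for b (paths \<delta> S p s)"
    "guard_for c (paths \<delta> S s s)" "guard_for d (paths \<delta> S s q)"
    using insert.IH by meson
  then have g: "test_free_guard (Plus a (Seq b (Seq (Star c) d)))"
    and a: "matches (\<lambda>_ _. False) a w = paths \<delta> S p q w"
    and b: "matches (\<lambda>_ _. False) b w = paths \<delta> S p s w"
    and c: "matches (\<lambda>_ _. False) c w = paths \<delta> S s s w"
    and d: "matches (\<lambda>_ _. False) d w = paths \<delta> S s q w" for w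
    by (auto simp: guard_for_def test_free_guard_def test_free_matches_def)
  let ?S = "insert s S"
  have mono: "paths \<delta> S p' q' w \<subseteq> paths \<delta> ?S p' q' w" for p' q' w
    by (rule paths_mono) auto
  have loop: "j \<in> paths \<delta> ?S s s w" if "j \<in> matches (\<lambda>_ _. False) (Star c) w" for j w
    using that
  proof (induction rule: star_induct)
    case zero
    then show ?case by (simp add: paths_def)
  next
    case (step m n)
    have "n \<in> paths \<delta> ?S s s (suffix m w)" using step.hyps(2) c mono by blast
    with step.IH show ?case by (rule paths_add) simp
  qed
  \<comment> \<open>Induction on the length: the part up to the first return to \<open>s\<close> is
    one round of \<open>c\<close>, and what remains is a shorter path from \<open>s\<close>.\<close>
  have unloop: "j \<in> matches (\<lambda>_ _. False) (Seq (Star c) d) w" if "j \<in> paths \<delta> ?S s q w" for j w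
    using that
  proof (induction j arbitrary: w rule: less_induct)
    case (less j)
    show ?case
    proof (cases "j \<in> paths \<delta> S s q w")
      case True
      then show ?thesis using d[of w] star_zero[of "\<lambda>_ _. False" c w]
        by (simp only: matches.simps(4) mem_Collect_eq) (metis add_0 suffix_0)
    next
      case False
      with less.prems obtain i where i: "0 < i" "i < j" "i \<in> paths \<delta> S s s w"
        "j - i \<in> paths \<delta> ?S s q (suffix i w)"
        by (rule paths_insert_cases)
      have "j - i \<in> matches (\<lambda>_ _. False) (Seq (Star c) d) (suffix i w)"
        by (rule less.IH[OF _ i(4)]) (use i in simp)
      then obtain m n where mn: "j - i = m + n" "m \<in> matches (\<lambda>_ _. False) (Star c) (suffix i w)"
        "n \<in> matches (\<lambda>_ _. False) d (suffix m (suffix i w))"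
        unfolding matches.simps(4) by blast
      have "i \<in> matches (\<lambda>_ _. False) c w" using i(3) c by simp
      then have "i + m \<in> matches (\<lambda>_ _. False) (Star c) w"
        using mn(2) by (rule star_add[OF star_one])
      moreover have "n \<in> matches (\<lambda>_ _. False) d (suffix (i + m) w)" using mn(3) by simp
      moreover have "j = (i + m) + n" using mn(1) i(2) by simp
      ultimately show ?thesis unfolding matches.simps(4) by blast
    qed
  qed
  have "test_free_matches (Plus a (Seq b (Seq (Star c) d))) w = paths \<delta> ?S p q w" (is "?L = ?R") for w
  proof
    show "?L \<subseteq> ?R"
    proof
      fix j
      assume "j \<in> ?L"
      then have "j \<in> paths \<delta> S p q w \<or> (\<exists>k m n. j = k + (m + n) \<and> k \<in> paths \<delta> S p s w
        \<and> m \<in> matches (\<lambda>_ _. False) (Star c) (suffix k w) \<and> n \<in> paths \<delta> S s q (suffix m (suffix k w)))"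
        unfolding test_free_matches_def matches.simps(3,4) a b d by blast
      then show "j \<in> ?R"
        using mono loop by (meson insertI1 paths_add subsetD)
    qed
    show "?R \<subseteq> ?L"
    proof
      fix j
      assume j: "j \<in> ?R"
      show "j \<in> ?L"
      proof (cases "j \<in> paths \<delta> S p q w")
        case True
        then show ?thesis by (simp add: test_free_matches_def a)
      next
        case False
        with j obtain i where i: "0 < i" "i < j" "i \<in> paths \<delta> S p s w"
          "j - i \<in> paths \<delta> ?S s q (suffix i w)"
          by (rule paths_insert_cases)
        moreover have "j = i + (j - i)" using i(2) by simp
        ultimately have "j \<in> matches (\<lambda>_ _. False) (Seq b (Seq (Star c) d)) w"
          using unloop[OF i(4)] b unfolding matches.simps(4)[of _ b] by blast
        then show ?thesis by (simp only: test_free_matches_def matches.simps(3) UnI2)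
      qed
    qed
  qed
  then show ?case using g unfolding guard_for_def by blast
qed


subsection \<open>Splitting matches at a position\<close>

text \<open>The form in which Kleene's theorem serves the box: a quantifier over the cut position
  \<open>m\<close> becomes a modality with guard \<open>g\<close>, and one over the matches from
  \<open>m\<close> on becomes a modality with guard \<open>h\<close>. The type of tests
  \<open>'g\<close> is free, so the pairs can be guards of Prompt-LDL.\<close>

lemma split_matches:
  fixes r :: "('p::finite, 'f) guard"
  obtains P :: "(('p, 'g) guard \<times> ('p, 'g) guard) set" where
    "finite P" "\<And>g h. (g, h) \<in> P \<Longrightarrow> test_free_guard g \<and> test_free_guard h"
    "\<And>w m. \<exists>(g, h)\<in>P. m \<in> test_free_matches g w"
    "\<And>g h w m. (g, h) \<in> P \<Longrightarrow> m \<in> test_free_matches g w \<Longrightarrow>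
       test_free_matches h (suffix m w) = {j. m + j \<in> test_free_matches r w}"
proof -
  define M where "M = test_free_matches r"
  define \<delta> :: "('p set word \<Rightarrow> nat set) \<Rightarrow> 'p set \<Rightarrow> 'p set word \<Rightarrow> nat set"
    where "\<delta> X a = (\<lambda>v. {j. Suc j \<in> X ([a] \<frown> v)})" for X a
  define Q where "Q = range (residual M)"
  \<comment> \<open>The accepting states: \<open>0\<close> belongs to a residual iff the prefix read
    is itself a match. No later letter affects this, so any continuation will do.\<close>
  define F where "F = {Y \<in> Q. 0 \<in> Y (\<lambda>_. {})}"
  have fin: "finite Q" unfolding Q_def M_def by (rule finite_residuals)
  have \<delta>: "\<delta> (residual M u) a = residual M (u @ [a])" for u a
    by (rule ext) (simp add: \<delta>_def residual_def)
  have run: "run \<delta> (residual M u) w n = residual M (u @ prefix n w)" for u w n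
    by (induction n) (simp_all add: \<delta>)
  \<comment> \<open>Every state met by the run is a residual, so with \<open>Q\<close> the condition
    on intermediate states always holds and only the end state counts.\<close>
  have paths: "j \<in> paths \<delta> Q (residual M u) Y w \<longleftrightarrow> residual M (u @ prefix j w) = Y" for u Y w j
    by (auto simp: paths_def run Q_def)
  have "\<exists>g :: ('p, 'g) guard. guard_for g (paths \<delta> Q (residual M []) X)" for X
    by (rule guard_for_paths[OF fin])
  then obtain g :: "_ \<Rightarrow> ('p, 'g) guard" where g: "guard_for (g X) (paths \<delta> Q (residual M []) X)" for X
    by metis
  have "\<exists>h :: ('p, 'g) guard. guard_for h (\<lambda>w. \<Union>Y\<in>F. paths \<delta> Q X Y w)" for X
    by (rule guard_for_Union) (auto simp: F_def fin intro: guard_for_paths)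
  then obtain h :: "_ \<Rightarrow> ('p, 'g) guard" where h: "guard_for (h X) (\<lambda>w. \<Union>Y\<in>F. paths \<delta> Q X Y w)" for X
    by metis
  have m_g: "m \<in> test_free_matches (g X) w \<longleftrightarrow> residual M (prefix m w) = X" for m X w
    using g[of X] paths[of m "[]"] by (simp add: guard_for_def)
  show ?thesis
  proof (rule that[of "(\<lambda>X. (g X, h X)) ` Q"])
    show "finite ((\<lambda>X. (g X, h X)) ` Q)" using fin by simp
    show "test_free_guard g' \<and> test_free_guard h'" if "(g', h') \<in> (\<lambda>X. (g X, h X)) ` Q" for g' h'
      using that g h by (auto simp: guard_for_def)
    show "\<exists>(g', h')\<in>(\<lambda>X. (g X, h X)) ` Q. m \<in> test_free_matches g' w" for w m
      using m_g by (auto simp: Q_def)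
  next
    fix g' h' w m
    assume "(g', h') \<in> (\<lambda>X. (g X, h X)) ` Q" and m: "m \<in> test_free_matches g' w"
    then obtain X where X: "g' = g X" "h' = h X" by auto
    have res: "X = residual M (prefix m w)" using m m_g[of m X w] X(1) by simp
    have "j \<in> test_free_matches h' (suffix m w) \<longleftrightarrow> m + j \<in> M w" for j
    proof -
      have pre: "prefix m w @ prefix j (suffix m w) = prefix (m + j) w"
        using subsequence_append[of w m j] subsequence_prefix_suffix[where i = m and j = "m + j" and w = w] by simp
      have "j \<in> test_free_matches h' (suffix m w) \<longleftrightarrow>
        (\<exists>Y\<in>F. j \<in> paths \<delta> Q (residual M (prefix m w)) Y (suffix m w))"
        using h[of X] by (simp add: guard_for_def X(2) res)
      also have "\<dots> \<longleftrightarrow> m + j \<in> M (prefix (m + j) w \<frown> (\<lambda>_. {}))"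
        unfolding paths pre by (auto simp: F_def Q_def) (auto simp: residual_def)
      \<comment> \<open>The dummy continuation from \<open>F\<close> is exchanged for the true one,
        which restores \<open>w\<close>.\<close>
      also have "\<dots> \<longleftrightarrow> m + j \<in> M (prefix (m + j) w \<frown> suffix (m + j) w)"
        unfolding M_def by (rule matches_conc_indep) simp
      finally show ?thesis by simp
    qed
    then show "test_free_matches h' (suffix m w) = {j. m + j \<in> test_free_matches r w}"
      unfolding M_def by blast
  qed
qed


subsection \<open>Translation\<close>

lemma prompt_Or_finite:
  assumes "finite I" "\<And>i. i \<in> I \<Longrightarrow> \<exists>\<psi>. \<forall>w k. P i w k \<longleftrightarrow> V_PromptLDL w k \<psi>"
  shows "\<exists>\<psi>. \<forall>w k. (\<exists>i\<in>I. P i w k) \<longleftrightarrow> V_PromptLDL w k \<psi>"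
  using assms
proof (induction I rule: finite_induct)
  case empty
  \<comment> \<open>The syntax has no constant for falsity; a diamond over a guard without matches
    is false whatever its argument.\<close>
  show ?case by (rule exI[of _ "Dia (Prop (PNeg PTrue)) (Atom undefined)"]) simp
next
  case (insert i I)
  obtain \<psi> where "\<forall>w k. P i w k \<longleftrightarrow> V_PromptLDL w k \<psi>"
    using insert.prems[OF insertI1] by (rule exE)
  moreover obtain \<chi> where "\<forall>w k. (\<exists>i\<in>I. P i w k) \<longleftrightarrow> V_PromptLDL w k \<chi>"
    using insert.IH[OF insert.prems[OF insertI2]] by (rule exE)
  ultimately show ?case by (intro exI[of _ "Or \<psi> \<chi>"]) simp
qed

lemma prompt_And_finite:
  assumes "finite I" "\<And>i. i \<in> I \<Longrightarrow> \<exists>\<psi>. \<forall>w k. P i w k \<longleftrightarrow> V_PromptLDL w k \<psi>"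
  shows "\<exists>\<psi>. \<forall>w k. (\<forall>i\<in>I. P i w k) \<longleftrightarrow> V_PromptLDL w k \<psi>"
  using assms
proof (induction I rule: finite_induct)
  case empty
  \<comment> \<open>Dually, a box over a guard without matches serves as truth.\<close>
  show ?case by (rule exI[of _ "Box (Prop (PNeg PTrue)) (Atom undefined)"]) simp
next
  case (insert i I)
  obtain \<psi> where "\<forall>w k. P i w k \<longleftrightarrow> V_PromptLDL w k \<psi>"
    using insert.prems[OF insertI1] by (rule exE)
  moreover obtain \<chi> where "\<forall>w k. (\<forall>i\<in>I. P i w k) \<longleftrightarrow> V_PromptLDL w k \<chi>"
    using insert.IH[OF insert.prems[OF insertI2]] by (rule exE)
  ultimately show ?case by (intro exI[of _ "And \<psi> \<chi>"]) simp
qed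

lemma V_PromptLDL_test_free:
  assumes "test_free_guard r"
  shows "V_PromptLDL w k (Dia r \<phi>) \<longleftrightarrow> (\<exists>j\<in>test_free_matches r w. V_PromptLDL (suffix j w) k \<phi>)"
    and "V_PromptLDL w k (Box r \<phi>) \<longleftrightarrow> (\<forall>j\<in>test_free_matches r w. V_PromptLDL (suffix j w) k \<phi>)"
    and "V_PromptLDL w k (PDia r \<phi>) \<longleftrightarrow>
      (\<exists>j\<in>test_free_matches r w \<inter> {0..k}. V_PromptLDL (suffix j w) k \<phi>)"
  by (simp_all add: matches_test_free[OF assms])

text \<open>The guards of the two logics differ in the type of their tests. A test-free guard
  contains nothing for \<open>f\<close> to act on, so it moves from one logic to the other with the
  same matches.\<close>

lemma guard_for_change_tests:
  assumes "test_free_guard r"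
  shows "guard_for (map_guard id f r) (test_free_matches r)"
  using assms
  by (auto simp: guard_for_def test_free_guard_def test_free_matches_def matches_map_guard guard.set_map)

text \<open>Infinitely many matches rule out the finite and empty cases of
  \<open>robust_box\<close>, so each bit is a plain quantifier pattern over the matches of
  \<open>r\<close>.\<close>

lemma robust_box_definable:
  fixes r :: "('p::finite, 'f) guard" and \<psi> :: "'p prompt_ldl"
  assumes "limit_matching_guard r"
  shows "\<exists>\<chi>. \<forall>w k. robust_box i (test_free_matches r w) (\<lambda>j. V_PromptLDL (suffix j w) k \<psi>)
    \<longleftrightarrow> V_PromptLDL w k \<chi>"
proof -
  let ?R = "test_free_matches r" and ?S = "\<lambda>w k j. V_PromptLDL (suffix j w) k \<psi>"
  have inf: "infinite (?R w)" "?R w \<noteq> {}" for w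
    using assms infinite_imp_nonempty unfolding limit_matching_guard_def by blast+
  obtain g :: "('p, 'p prompt_ldl) guard" where "guard_for g ?R"
    using guard_for_change_tests assms unfolding limit_matching_guard_def by blast
  then have g: "test_free_guard g" "test_free_matches g w = ?R w" for w
    by (auto simp: guard_for_def)
  have shift: "?R w \<inter> {m..} = (\<lambda>j. m + j) ` {j. m + j \<in> ?R w}" for w m
    by (auto simp: image_def le_iff_add)
  obtain P :: "(('p, 'p prompt_ldl) guard \<times> ('p, 'p prompt_ldl) guard) set" where P:
    "finite P" "\<And>g h. (g, h) \<in> P \<Longrightarrow> test_free_guard g \<and> test_free_guard h"
    "\<And>w m. \<exists>(g, h)\<in>P. m \<in> test_free_matches g w"
    "\<And>g h w m. (g, h) \<in> P \<Longrightarrow> m \<in> test_free_matches g w \<Longrightarrow>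
       test_free_matches h (suffix m w) = {j. m + j \<in> test_free_matches r w}"
    using split_matches[of r] by metis
  consider "i = 1" | "i = 2" | "i = 3" | "i \<notin> {1, 2, 3}" by blast
  then show ?thesis
  proof cases
    case 1
    then show ?thesis
      by (intro exI[of _ "Box g \<psi>"]) (simp add: robust_box_def inf V_PromptLDL_test_free g del: V_PromptLDL.simps)
  next
    case 2
    \<comment> \<open>Once \<open>g\<close> has fixed \<open>m\<close>, the matches of
      \<open>h\<close> are those of \<open>r\<close> from \<open>m\<close> on, shifted by
      \<open>m\<close>.\<close>
    have split: "V_PromptLDL w k (Dia g (Box h \<psi>)) \<longleftrightarrow>
      (\<exists>m\<in>test_free_matches g w. \<forall>j\<in>?R w \<inter> {m..}. ?S w k j)" if "(g, h) \<in> P" for g h w k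
    proof -
      have "(\<forall>j\<in>test_free_matches h (suffix m w). ?S (suffix m w) k j) \<longleftrightarrow>
        (\<forall>j\<in>?R w \<inter> {m..}. ?S w k j)" if "m \<in> test_free_matches g w" for m
        using P(4)[OF \<open>(g, h) \<in> P\<close> that] by (simp add: shift)
      then show ?thesis using P(2)[OF that] by (simp add: V_PromptLDL_test_free del: V_PromptLDL.simps)
    qed
    have "V_PromptLDL w k (Dia (fst x) (Box (snd x) \<psi>)) \<longleftrightarrow>
      (\<exists>m\<in>test_free_matches (fst x) w. \<forall>j\<in>?R w \<inter> {m..}. ?S w k j)" if "x \<in> P" for x w k
      using that by (intro split) simp
    \<comment> \<open>The first guards together match every position, so the disjunction over
      \<open>P\<close> lets the threshold \<open>m\<close> range over all positions.\<close>
    moreover have "\<exists>x\<in>P. m \<in> test_free_matches (fst x) w" for w m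
      using P(3)[of m w] by (simp add: split_beta)
    then have "robust_box i (?R w) (?S w k) \<longleftrightarrow>
      (\<exists>x\<in>P. \<exists>m\<in>test_free_matches (fst x) w. \<forall>j\<in>?R w \<inter> {m..}. ?S w k j)" for w k
      using 2 inf[of w] unfolding robust_box_def by simp blast
    ultimately have "robust_box i (?R w) (?S w k) \<longleftrightarrow>
      (\<exists>x\<in>P. V_PromptLDL w k (Dia (fst x) (Box (snd x) \<psi>)))" for w k
      by (simp del: V_PromptLDL.simps)
    then show ?thesis
      by (simp only:) (rule prompt_Or_finite[OF P(1)], rule exI, intro allI, rule refl)
  next
    case 3
    \<comment> \<open>The dual of bit 2: every threshold \<open>m\<close> must be passed, so the
      modalities are exchanged and all pairs in \<open>P\<close> are required.\<close>
    have split: "V_PromptLDL w k (Box g (Dia h \<psi>)) \<longleftrightarrow>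
      (\<forall>m\<in>test_free_matches g w. \<exists>j\<in>?R w \<inter> {m..}. ?S w k j)" if "(g, h) \<in> P" for g h w k
    proof -
      have "(\<exists>j\<in>test_free_matches h (suffix m w). ?S (suffix m w) k j) \<longleftrightarrow>
        (\<exists>j\<in>?R w \<inter> {m..}. ?S w k j)" if "m \<in> test_free_matches g w" for m
        using P(4)[OF \<open>(g, h) \<in> P\<close> that] by (simp add: shift)
      then show ?thesis using P(2)[OF that] by (simp add: V_PromptLDL_test_free del: V_PromptLDL.simps)
    qed
    have "V_PromptLDL w k (Box (fst x) (Dia (snd x) \<psi>)) \<longleftrightarrow>
      (\<forall>m\<in>test_free_matches (fst x) w. \<exists>j\<in>?R w \<inter> {m..}. ?S w k j)" if "x \<in> P" for x w k
      using that by (intro split) simp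
    moreover have "\<exists>x\<in>P. m \<in> test_free_matches (fst x) w" for w m
      using P(3)[of m w] by (simp add: split_beta)
    then have "robust_box i (?R w) (?S w k) \<longleftrightarrow>
      (\<forall>x\<in>P. \<forall>m\<in>test_free_matches (fst x) w. \<exists>j\<in>?R w \<inter> {m..}. ?S w k j)" for w k
      using 3 inf[of w] unfolding robust_box_def by simp blast
    ultimately have "robust_box i (?R w) (?S w k) \<longleftrightarrow>
      (\<forall>x\<in>P. V_PromptLDL w k (Box (fst x) (Dia (snd x) \<psi>)))" for w k
      by (simp del: V_PromptLDL.simps)
    then show ?thesis
      by (simp only:) (rule prompt_And_finite[OF P(1)], rule exI, intro allI, rule refl)
  next
    case 4
    then show ?thesis
      by (intro exI[of _ "Dia g \<psi>"]) (simp add: robust_box_def inf V_PromptLDL_test_free g del: V_PromptLDL.simps)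
  qed
qed

section \<open>Bitwise translation of formulas\<close>

lemma bit4_min: "bit4 i (min a b) \<longleftrightarrow> bit4 i a \<and> bit4 i b"
  by (auto simp: min_def bit4_def less_eq_b4_def)

lemma bit4_max: "bit4 i (max a b) \<longleftrightarrow> bit4 i a \<or> bit4 i b"
  by (auto simp: max_def bit4_def less_eq_b4_def)

text \<open>The index \<open>i\<close> is kept arbitrary in the induction, because bit
  \<open>i\<close> of a box needs the hypothesis for all smaller indices as well.\<close>

lemma bit_definable:
  fixes \<phi> :: "'p::finite rprompt_ldl"
  assumes "limit_matching \<phi>" "i \<in> {1..4}"
  shows "\<exists>\<psi>. \<forall>w k. bit4 i (V_rPromptLDL w k \<phi>) \<longleftrightarrow> V_PromptLDL w k \<psi>"
  using assms
proof (induction \<phi> arbitrary: i)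
  case (RAtom p)
  then show ?case by (intro exI[of _ "Atom p"]) (auto simp: bit4_def)
next
  case (RNAtom p)
  then show ?case by (intro exI[of _ "NAtom p"]) (auto simp: bit4_def)
next
  case (RAnd \<phi>\<^sub>1 \<phi>\<^sub>2)
  have lim: "limit_matching \<phi>\<^sub>1" "limit_matching \<phi>\<^sub>2"
    using RAnd.prems(1) by (auto simp: limit_matching_def)
  obtain \<psi>\<^sub>1 \<psi>\<^sub>2 where "\<forall>w k. bit4 i (V_rPromptLDL w k \<phi>\<^sub>1) \<longleftrightarrow> V_PromptLDL w k \<psi>\<^sub>1"
    "\<forall>w k. bit4 i (V_rPromptLDL w k \<phi>\<^sub>2) \<longleftrightarrow> V_PromptLDL w k \<psi>\<^sub>2"
    using RAnd.IH(1)[OF lim(1) RAnd.prems(2)] RAnd.IH(2)[OF lim(2) RAnd.prems(2)] by blast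
  then show ?case by (intro exI[of _ "And \<psi>\<^sub>1 \<psi>\<^sub>2"]) (simp add: bit4_min)
next
  case (ROr \<phi>\<^sub>1 \<phi>\<^sub>2)
  have lim: "limit_matching \<phi>\<^sub>1" "limit_matching \<phi>\<^sub>2"
    using ROr.prems(1) by (auto simp: limit_matching_def)
  obtain \<psi>\<^sub>1 \<psi>\<^sub>2 where "\<forall>w k. bit4 i (V_rPromptLDL w k \<phi>\<^sub>1) \<longleftrightarrow> V_PromptLDL w k \<psi>\<^sub>1"
    "\<forall>w k. bit4 i (V_rPromptLDL w k \<phi>\<^sub>2) \<longleftrightarrow> V_PromptLDL w k \<psi>\<^sub>2"
    using ROr.IH(1)[OF lim(1) ROr.prems(2)] ROr.IH(2)[OF lim(2) ROr.prems(2)] by blast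
  then show ?case by (intro exI[of _ "Or \<psi>\<^sub>1 \<psi>\<^sub>2"]) (simp add: bit4_max)
next
  case (RDia r \<phi>)
  have lim: "limit_matching \<phi>" and r: "test_free_guard r"
    using RDia.prems(1) by (auto simp: limit_matching_def limit_matching_guard_def)
  from RDia.IH(2)[OF lim RDia.prems(2)] obtain \<psi> where
    \<psi>: "\<And>w k. bit4 i (V_rPromptLDL w k \<phi>) \<longleftrightarrow> V_PromptLDL w k \<psi>" by blast
  obtain g :: "('p, 'p prompt_ldl) guard" where "guard_for g (test_free_matches r)"
    using guard_for_change_tests[OF r] by blast
  then have g: "test_free_guard g" "test_free_matches g w = test_free_matches r w" for w
    by (auto simp: guard_for_def)
  show ?case
    by (intro exI[of _ "Dia g \<psi>"])
      (simp add: bit4_RDia[OF RDia.prems(2)] matches_test_free[OF r] V_PromptLDL_test_free g \<psi>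
        del: V_PromptLDL.simps V_rPromptLDL.simps)
next
  case (RBox r \<phi>)
  have lim: "limit_matching \<phi>" and r: "limit_matching_guard r" "test_free_guard r"
    using RBox.prems(1) by (auto simp: limit_matching_def limit_matching_guard_def)
  let ?bit = "\<lambda>i w k. robust_box i (test_free_matches r w)
    (\<lambda>j. bit4 i (V_rPromptLDL (suffix j w) k \<phi>))"
  have "\<exists>\<chi>. \<forall>w k. ?bit i' w k \<longleftrightarrow> V_PromptLDL w k \<chi>" if i': "i' \<in> {1..i}" for i'
  proof -
    have "i' \<in> {1..4}" using i' RBox.prems(2) by simp
    from RBox.IH(2)[OF lim this] obtain \<psi> where
      "\<And>w k. bit4 i' (V_rPromptLDL w k \<phi>) \<longleftrightarrow> V_PromptLDL w k \<psi>" by blast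
    then show ?thesis using robust_box_definable[OF r(1), of i' \<psi>] by simp
  qed
  \<comment> \<open>Since \<open>of_bits\<close> accumulates from the left, bit \<open>i\<close> of
    the box is the disjunction of the raw bits up to \<open>i\<close>.\<close>
  then have "\<exists>\<chi>. \<forall>w k. (\<exists>i'\<in>{1..i}. ?bit i' w k) \<longleftrightarrow> V_PromptLDL w k \<chi>"
    by (intro prompt_Or_finite) auto
  then show ?case
    by (simp only: V_rPromptLDL.simps bit4_of_bits[OF RBox.prems(2)] matches_test_free[OF r(2)])
next
  case (RPDia r \<phi>)
  have lim: "limit_matching \<phi>" and r: "test_free_guard r"
    using RPDia.prems(1) by (auto simp: limit_matching_def limit_matching_guard_def)
  from RPDia.IH(2)[OF lim RPDia.prems(2)] obtain \<psi> where
    \<psi>: "\<And>w k. bit4 i (V_rPromptLDL w k \<phi>) \<longleftrightarrow> V_PromptLDL w k \<psi>" by blast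
  obtain g :: "('p, 'p prompt_ldl) guard" where "guard_for g (test_free_matches r)"
    using guard_for_change_tests[OF r] by blast
  then have g: "test_free_guard g" "test_free_matches g w = test_free_matches r w" for w
    by (auto simp: guard_for_def)
  \<comment> \<open>The matches are the same positions in both logics, so the bound
    \<open>{0..k}\<close> carries over unchanged.\<close>
  show ?case
    by (intro exI[of _ "PDia g \<psi>"])
      (simp add: bit4_RPDia[OF RPDia.prems(2)] matches_test_free[OF r] V_PromptLDL_test_free g \<psi>
        del: V_PromptLDL.simps V_rPromptLDL.simps)
qed

theorem theorem8:
  fixes \<phi> :: "'p::finite rprompt_ldl" and \<beta> :: b4
  assumes "test_free \<phi>" and "limit_matching \<phi>"
  shows "\<exists>\<phi>\<^sub>\<beta> :: 'p prompt_ldl. \<forall>w k. V_rPromptLDL w k \<phi> \<ge> \<beta> \<longleftrightarrow> V_PromptLDL w k \<phi>\<^sub>\<beta>"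
proof (cases "\<beta> = B0000")
  case True
  \<comment> \<open>Every value is at least \<open>B0000\<close>, so a valid formula is wanted;
    again a box without matches.\<close>
  then show ?thesis
    by (intro exI[of _ "Box (Prop (PNeg PTrue)) (Atom undefined)"]) (simp add: less_eq_b4_def)
next
  case False
  \<comment> \<open>Values are zeros followed by ones, and \<open>5 - ones \<beta>\<close> is the
    index of the leftmost one of \<open>\<beta>\<close>. Reaching \<open>\<beta>\<close> thus means
    having this single bit set.\<close>
  then have "5 - ones \<beta> \<in> {1..4}" and ge: "b \<ge> \<beta> \<longleftrightarrow> bit4 (5 - ones \<beta>) b" for b
    by (cases \<beta>; auto simp: bit4_def less_eq_b4_def)+
  from bit_definable[OF assms(2) this(1)] show ?thesis unfolding ge .
qed

end
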